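(* The Baumslag-Gersten group $G = \langle x, y, t \mid x^y = x^2,\ x^t = y\rangle$ is both Hopfian and co-Hopfian.
   Context: Notation: $a^b = b^{-1} a b$. A group is Hopfian if every surjective endomorphism of it is an automorphism, and co-Hopfian if every injective endomorphism of it is an automorphism. *)

theory Defs
  imports "HOL-Algebra.Group"
begin

section \<open>Groups given by generators and relations\<close>

text \<open>
  Words in the letters \<open>g\<close> and \<open>g\<inverse>\<close>, where \<open>(g, True)\<close> stands for \<open>g\<close> and
  \<open>(g, False)\<close> for \<open>g\<inverse>\<close>. The generating set of a presentation is the whole type \<open>'g\<close>;
  a relation \<open>l = r\<close> is the pair of words \<open>(l, r)\<close>.
\<close>

type_synonym 'g word = "('g \<times> bool) list"

definition gen_word :: "'g \<Rightarrow> 'g word" where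
  "gen_word g = [(g, True)]"

definition inv_word :: "'g word \<Rightarrow> 'g word" where
  "inv_word w = rev (map (\<lambda>(g, e). (g, \<not> e)) w)"

definition conj_word :: "'g word \<Rightarrow> 'g word \<Rightarrow> 'g word" where
  "conj_word a b = inv_word b @ a @ b"

inductive word_eq :: "('g word \<times> 'g word) set \<Rightarrow> 'g word \<Rightarrow> 'g word \<Rightarrow> bool"
  for R where
  refl: "word_eq R w w"
| sym: "word_eq R v w \<Longrightarrow> word_eq R w v"
| trans: "word_eq R u v \<Longrightarrow> word_eq R v w \<Longrightarrow> word_eq R u w"
| cancel: "word_eq R (u @ [(g, e), (g, \<not> e)] @ v) (u @ v)"
| rel: "(l, r) \<in> R \<Longrightarrow> word_eq R (u @ l @ v) (u @ r @ v)"

definition word_rel :: "('g word \<times> 'g word) set \<Rightarrow> ('g word \<times> 'g word) set" where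
  "word_rel R = {(v, w). word_eq R v w}"

definition presented_group :: "('g word \<times> 'g word) set \<Rightarrow> 'g word set monoid" where
  "presented_group R =
    \<lparr> carrier = UNIV // word_rel R,
      mult = (\<lambda>A B. \<Union>u\<in>A. \<Union>v\<in>B. word_rel R `` {u @ v}),
      one = word_rel R `` {[]} \<rparr>"

definition word_class :: "('g word \<times> 'g word) set \<Rightarrow> 'g word \<Rightarrow> 'g word set" where
  "word_class R w = word_rel R `` {w}"

lemma equiv_word_rel: "equiv UNIV (word_rel R)"
proof (rule equivI)
  show "refl_on UNIV (word_rel R)"
    by (simp add: refl_on_def word_rel_def word_eq.refl)
  show "Relation.sym (word_rel R)"
    by (rule symI) (simp add: word_rel_def word_eq.sym)
  show "Relation.trans (word_rel R)"
    by (rule transI) (simp add: word_rel_def, rule word_eq.trans)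
qed simp

lemma word_eq_append_left: "word_eq R v w \<Longrightarrow> word_eq R (u @ v) (u @ w)"
proof (induction rule: word_eq.induct)
  case (cancel a g e b)
  show ?case using word_eq.cancel[of R "u @ a" g e b] by simp
next
  case (rel l r a b)
  then show ?case using word_eq.rel[of l r R "u @ a" b] by simp
next
  case (trans a b c)
  from trans.IH show ?case by (rule word_eq.trans)
qed (simp_all add: word_eq.refl word_eq.sym)

lemma word_eq_append_right: "word_eq R v w \<Longrightarrow> word_eq R (v @ u) (w @ u)"
proof (induction rule: word_eq.induct)
  case (cancel a g e b)
  show ?case using word_eq.cancel[of R a g e "b @ u"] by simp
next
  case (rel l r a b)
  then show ?case using word_eq.rel[of l r R a "b @ u"] by simp
next
  case (trans a b c)
  from trans.IH show ?case by (rule word_eq.trans)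
qed (simp_all add: word_eq.refl word_eq.sym)

lemma word_eq_append:
  "word_eq R u u' \<Longrightarrow> word_eq R v v' \<Longrightarrow> word_eq R (u @ v) (u' @ v')"
  by (rule word_eq.trans[OF word_eq_append_right word_eq_append_left])

lemma word_class_eq_iff: "word_class R v = word_class R w \<longleftrightarrow> word_eq R v w"
  unfolding word_class_def
  by (subst eq_equiv_class_iff[OF equiv_word_rel]) (auto simp: word_rel_def)

lemma carrier_presented_group: "carrier (presented_group R) = range (word_class R)"
  by (auto simp: presented_group_def word_class_def quotient_def)

lemma one_presented_group: "\<one>\<^bsub>presented_group R\<^esub> = word_class R []"
  by (simp add: presented_group_def word_class_def)

lemma mult_presented_group:
  "word_class R u \<otimes>\<^bsub>presented_group R\<^esub> word_class R v = word_class R (u @ v)"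
proof -
  have "congruent2 (word_rel R) (word_rel R) (\<lambda>u v. word_rel R `` {u @ v})"
    using word_class_eq_iff[of R, unfolded word_class_def]
    by (intro congruent2I') (simp add: word_rel_def word_eq_append)
  then show ?thesis
    using UN_equiv_class2[OF equiv_word_rel equiv_word_rel]
    by (simp add: presented_group_def word_class_def)
qed

lemma word_eq_inv_word: "word_eq R (inv_word w @ w) []"
proof (induction w)
  case Nil
  show ?case by (simp add: inv_word_def word_eq.refl)
next
  case (Cons a w)
  obtain g e where a: "a = (g, e)" by (cases a)
  have "word_eq R (inv_word w @ [(g, \<not> e), (g, \<not> \<not> e)] @ w) (inv_word w @ w)"
    by (rule word_eq.cancel)
  then show ?case
    using word_eq.trans[OF _ Cons.IH] by (simp add: a inv_word_def)
qed

lemma group_presented_group: "group (presented_group R)"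
proof (rule groupI)
  fix A assume "A \<in> carrier (presented_group R)"
  then obtain w where "A = word_class R w" by (auto simp: carrier_presented_group)
  then show "\<exists>B\<in>carrier (presented_group R). B \<otimes>\<^bsub>presented_group R\<^esub> A = \<one>\<^bsub>presented_group R\<^esub>"
    using word_eq_inv_word[of R w]
    by (auto simp: carrier_presented_group one_presented_group mult_presented_group
        word_class_eq_iff)
qed (auto simp: carrier_presented_group one_presented_group mult_presented_group)


section \<open>Hopfian and co-Hopfian groups\<close>

definition hopfian :: "('a, 'b) monoid_scheme \<Rightarrow> bool" where
  "hopfian G \<longleftrightarrow> (\<forall>f\<in>hom G G. f ` carrier G = carrier G \<longrightarrow> f \<in> iso G G)"

definition co_hopfian :: "('a, 'b) monoid_scheme \<Rightarrow> bool" where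
  "co_hopfian G \<longleftrightarrow> (\<forall>f\<in>hom G G. inj_on f (carrier G) \<longrightarrow> f \<in> iso G G)"


section \<open>The Baumslag-Gersten group\<close>

datatype bg_gen = BG_x | BG_y | BG_t

definition baumslag_gersten :: "bg_gen word set monoid" where
  "baumslag_gersten =
    (let x = gen_word BG_x; y = gen_word BG_y; t = gen_word BG_t
     in presented_group {(conj_word x y, x @ x), (conj_word x t, y)})"

end

theory Submission
  imports Defs Complex_Main
begin

text \<open>
  The group is an HNN extension of \<open>B = \<langle>x, y\<rangle> \<cong> \<int>[1/2] \<rtimes> \<int>\<close> with stable letter \<open>t\<close>
  conjugating \<open>x\<close> to \<open>y\<close>; its action on normal forms yields Britton's lemma. If \<open>a\<^sup>b = a\<^sup>2\<close> and
  \<open>a\<^sup>s = b\<close> with \<open>a \<noteq> 1\<close>, then \<open>a\<close> is conjugate into \<open>B\<close>, since otherwise the lengths of the powers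
  \<open>a\<^sup>N\<close> with \<open>N = 2\<^sup>k\<close> would grow exponentially in \<open>k\<close>, although these are conjugates of \<open>a\<close> by \<open>b\<^sup>k\<close>.
  Britton's lemma then makes \<open>a\<close> conjugate to a power of \<open>x\<close>. An element that conjugates a
  nontrivial power of \<open>x\<close> to a power of \<open>x\<close> lies in \<open>B\<close>, and this forces the pair \<open>(a, b)\<close> to be
  conjugate to \<open>(x, y)\<close>. So an endomorphism that does not kill \<open>x\<close> is, up to an inner automorphism,
  \<open>x \<mapsto> x, y \<mapsto> y, t \<mapsto> c t\<close> with \<open>c \<in> B\<close> centralizing \<open>x\<close>, which is invertible. An endomorphism
  that kills \<open>x\<close> has cyclic image and is neither injective nor surjective.
\<close>

section \<open>Integer multiples in additively written groups\<close>

definition zmul :: "int \<Rightarrow> 'a::group_add \<Rightarrow> 'a" where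
  "zmul m a = (if m \<ge> 0 then ((+) a ^^ nat m) 0 else - (((+) a ^^ nat (- m)) 0))"

lemma funpow_plus_commute: "a + ((+) a ^^ n) 0 = ((+) a ^^ n) 0 + (a::'a::group_add)"
proof (induction n)
  case (Suc n)
  then show ?case by (metis add.assoc funpow.simps(2) o_apply)
qed simp

lemma zmul_0 [simp]: "zmul 0 a = 0"
  by (simp add: zmul_def)

lemma zmul_add_1: "zmul (m + 1) a = zmul m a + a"
proof (cases "m \<ge> 0")
  case True
  then have "nat (m + 1) = Suc (nat m)" by simp
  then show ?thesis using True by (simp add: zmul_def funpow_plus_commute)
next
  case False
  define n where "n = nat (- m - 1)"
  have n: "nat (- m) = Suc n" "m + 1 = - int n" using False by (auto simp: n_def)
  have "zmul (m + 1) a = - (((+) a ^^ n) 0)"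
    unfolding n(2) by (cases n) (simp_all add: zmul_def nat_add_distrib del: of_nat_Suc)
  moreover have "zmul m a = - (((+) a ^^ n) 0) - a"
    using False n(1) by (simp add: zmul_def minus_add)
  ultimately show ?thesis by (simp add: add.assoc)
qed

lemma zmul_1 [simp]: "zmul 1 a = a"
  using zmul_add_1[of 0 a] by simp

lemma zmul_diff_1: "zmul (m - 1) a = zmul m a - a"
  using zmul_add_1[of "m - 1" a] by simp

lemma zmul_add: "zmul (m + n) a = zmul m a + zmul n a"
proof (induction n rule: int_induct[where k = 0])
  case base
  show ?case by simp
next
  case (step1 i)
  then show ?case using zmul_add_1[of "m + i" a] zmul_add_1[of i a] by (simp add: add.assoc)
next
  case (step2 i)
  then show ?case using zmul_diff_1[of "m + i" a] zmul_diff_1[of i a]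
    by (simp add: add_diff_eq)
qed

lemma zmul_minus: "zmul (- m) a = - zmul m a"
  using zmul_add[of "- m" m a] by (simp add: eq_neg_iff_add_eq_0)

lemma zmul_diff: "zmul (m - n) a = zmul m a - zmul n a"
  using zmul_add[of "m - n" n a] by (simp add: eq_diff_eq)

lemma zmul_zmul: "zmul m (zmul n a) = zmul (n * m) a"
  by (induction m rule: int_induct[where k = 0])
    (simp_all add: zmul_add_1 zmul_diff_1 zmul_add zmul_diff distrib_left right_diff_distrib)

locale additive_map =
  fixes f :: "'a::group_add \<Rightarrow> 'b::group_add"
  assumes add: "f (a + b) = f a + f b"
begin

lemma zero [simp]: "f 0 = 0"
  using add[of 0 0] add_left_cancel[of "f 0" "f 0" 0] by simp

lemma minus: "f (- a) = - f a"
  using add[of "- a" a] by (simp add: eq_neg_iff_add_eq_0)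

lemma diff: "f (a - b) = f a - f b"
  using add[of a "- b"] by (simp add: minus)

lemma zmul: "f (zmul m a) = zmul m (f a)"
  by (induction m rule: int_induct[where k = 0]) (simp_all add: zmul_add_1 zmul_diff_1 add diff)

end

lemma zmul_conj: "zmul m (- g + a + g) = - g + zmul m a + (g::'a::group_add)"
proof -
  interpret additive_map "\<lambda>a. - g + a + g"
    by unfold_locales (simp add: add.assoc)
  show ?thesis by (simp add: zmul)
qed

section \<open>The affine group containing the base group\<close>

text \<open>
  \<open>Aff r k\<close> stands for \<open>x\<^sup>r y\<^sup>k\<close> in \<open>\<rat> \<rtimes> \<int>\<close>, where \<open>y\<close> acts by halving. All groups
  are written additively, although they are not commutative.
\<close>

datatype aff = Aff rat int

instantiation aff :: group_add
begin

definition "0 = Aff 0 0"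

fun plus_aff where
  "Aff r k + Aff s l = Aff (r + 2 powi (- k) * s) (k + l)"

fun uminus_aff where
  "- Aff r k = Aff (- (2 powi k * r)) (- k)"

definition "p - q = p + - (q::aff)"

instance
proof
  fix p q u :: aff
  show "p + q + u = p + (q + u)"
    by (cases p; cases q; cases u)
      (simp add: power_int_diff power_int_minus field_simps)
  show "0 + p = p" "p + 0 = p"
    by (cases p; simp add: zero_aff_def)+
  show "- p + p = 0"
    by (cases p) (simp add: zero_aff_def)
  show "p + - q = p - q"
    by (simp add: minus_aff_def)
qed

end

text \<open>
  \<open>True\<close> stands for the letter \<open>t\<close> with associated subgroup \<open>\<langle>x\<rangle>\<close>, \<open>False\<close> for its inverse
  with associated subgroup \<open>\<langle>y\<rangle>\<close>.
\<close>

fun sub :: "bool \<Rightarrow> int \<Rightarrow> aff" where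
  "sub True n = Aff (of_int n) 0"
| "sub False n = Aff 0 n"

text \<open>A transversal of the left cosets of the subgroup \<open>range (sub e)\<close>. Right
  multiplication of \<open>Aff r k\<close> by x^n shifts \<open>r\<close> by 2^(-k) n, so the
  fractional part of 2^k r selects the representative. For y only the second coordinate moves and is
  reset to 0.\<close>

fun rep :: "bool \<Rightarrow> aff \<Rightarrow> aff" where
  "rep True (Aff r k) = Aff (r - 2 powi (- k) * of_int \<lfloor>2 powi k * r\<rfloor>) k"
| "rep False (Aff r k) = Aff r 0"

fun carry :: "bool \<Rightarrow> aff \<Rightarrow> int" where
  "carry True (Aff r k) = \<lfloor>2 powi k * r\<rfloor>"
| "carry False (Aff r k) = k"

lemma sub_add: "sub e (m + n) = sub e m + sub e n"
  by (cases e) simp_all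

lemma sub_0 [simp]: "sub e 0 = 0"
  by (cases e) (simp_all add: zero_aff_def)

lemma sub_minus: "sub e (- m) = - sub e m"
  using sub_add[of e "- m" m] by (simp add: eq_neg_iff_add_eq_0)

lemma rep_carry: "rep e p + sub e (carry e p) = p"
  by (cases e; cases p) simp_all

lemma rep_carry_sub: "rep e (p + sub e n) = rep e p \<and> carry e (p + sub e n) = carry e p + n"
  by (cases e; cases p) (simp_all add: algebra_simps power_int_minus)

lemmas rep_sub [simp] = rep_carry_sub[THEN conjunct1]
lemmas carry_sub [simp] = rep_carry_sub[THEN conjunct2]

lemma rep_carry_0 [simp]: "rep e 0 = 0" "carry e 0 = 0"
  by (cases e; simp add: zero_aff_def)+

lemma rep_add_rep: "rep e (p + rep e q) = rep e (p + q)"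
  using rep_sub[of e "p + rep e q" "carry e q"] by (simp add: add.assoc rep_carry)

text \<open>The cocycle identity of the transversal, which makes \<open>base_act\<close> a genuine
  action.\<close>

lemma carry_add_rep: "carry e (p + q) = carry e (p + rep e q) + carry e q"
  using carry_sub[of e "p + rep e q" "carry e q"] by (simp add: add.assoc rep_carry)

lemma rep_rep [simp]: "rep e (rep e p) = rep e p"
  using rep_add_rep[of e 0 p] by simp

lemma carry_rep [simp]: "carry e (rep e p) = 0"
  using carry_add_rep[of e 0 p] by simp

lemma rep_sub_0 [simp]: "rep e (sub e n) = 0" "carry e (sub e n) = n"
  using rep_sub[of e 0 n] carry_sub[of e 0 n] by simp_all

lemma rep_eq_imp_sub:
  assumes "rep e p = rep e q"
  shows "\<exists>n. - q + p = sub e n"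
proof -
  have "- q + p = - (rep e q + sub e (carry e q)) + (rep e p + sub e (carry e p))"
    by (simp add: rep_carry)
  also have "\<dots> = sub e (- carry e q + carry e p)"
    by (simp only: assms minus_add sub_add sub_minus add.assoc minus_add_cancel)
  finally show ?thesis by blast
qed

text \<open>\<open>rep e q = 0\<close> expresses membership of \<open>q\<close> in the associated
  subgroup, and left multiplication by an element of that subgroup does not affect it.\<close>

lemma rep_sub_left: "rep e (sub e n + q) = 0 \<longleftrightarrow> rep e q = 0"
proof -
  have *: "rep e (sub e m + p) = 0" if "rep e p = 0" for m p
  proof -
    have "p = sub e (carry e p)" using rep_carry[of e p] that by simp
    then show ?thesis by (metis rep_sub_0(1) sub_add)
  qed
  have "sub e (- n) + (sub e n + q) = q"
    by (simp add: sub_minus)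
  then show ?thesis using *[of "sub e n + q" "- n"] *[of q n] by auto
qed

section \<open>The action on normal forms\<close>

text \<open>
  \<open>Edge c e n\<close> stands for the product of \<open>c\<close>, the letter \<open>t\<close> or its inverse according to \<open>e\<close>, and
  \<open>n\<close>, where \<open>c\<close> represents a left coset of the associated subgroup.
\<close>

datatype nf = Base aff | Edge aff bool nf

fun cancels :: "bool \<Rightarrow> nf \<Rightarrow> bool" where
  "cancels e (Base p) = False"
| "cancels e (Edge c e' n) = (c = 0 \<and> e' = (\<not> e))"

fun reduced_nf :: "nf \<Rightarrow> bool" where
  "reduced_nf (Base p) = True"
| "reduced_nf (Edge c e n) = (rep e c = c \<and> \<not> cancels e n \<and> reduced_nf n)"

text \<open>The product of \<open>p\<close> and \<open>c\<close> splits into a coset representative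
  and a subgroup element. The latter crosses the letter by x t = t y, turns into a power of the
  other associated generator, and acts on the rest.\<close>

fun base_act :: "aff \<Rightarrow> nf \<Rightarrow> nf" where
  "base_act p (Base q) = Base (p + q)"
| "base_act p (Edge c e n) = Edge (rep e (p + c)) e (base_act (sub (\<not> e) (carry e (p + c))) n)"

fun tail :: "nf \<Rightarrow> nf" where
  "tail (Base p) = Base p"
| "tail (Edge c e n) = n"

definition t_act :: "bool \<Rightarrow> nf \<Rightarrow> nf" where
  "t_act e n = (if cancels e n then tail n else Edge 0 e n)"

fun nf_length :: "nf \<Rightarrow> nat" where
  "nf_length (Base p) = 0"
| "nf_length (Edge c e n) = Suc (nf_length n)"

section \<open>Group laws for the action on normal forms\<close>

lemma base_act_add: "base_act (p + q) n = base_act p (base_act q n)"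
proof (induction n arbitrary: p q)
  case (Base u)
  show ?case by (simp add: add.assoc)
next
  case (Edge c e n)
  have "carry e (p + q + c) = carry e (p + rep e (q + c)) + carry e (q + c)"
    using carry_add_rep[of e p "q + c"] by (simp add: add.assoc)
  then show ?case
    by (simp add: Edge.IH[symmetric] sub_add[symmetric] rep_add_rep add.assoc)
qed

lemma base_act_0: "reduced_nf n \<Longrightarrow> base_act 0 n = n"
proof (induction n)
  case (Edge c e n)
  then have "carry e c = 0" by (metis carry_rep reduced_nf.simps(2))
  with Edge show ?case by simp
qed simp

lemma cancels_base_act: "cancels e (base_act (sub (\<not> e) m) n) = cancels e n" if "reduced_nf n"
  using that by (cases n) (use rep_sub_left in fastforce)+

lemma reduced_base_act: "reduced_nf n \<Longrightarrow> reduced_nf (base_act p n)"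
  by (induction n arbitrary: p) (simp_all add: cancels_base_act)

lemma reduced_t_act: "reduced_nf n \<Longrightarrow> reduced_nf (t_act e n)"
  by (cases n) (auto simp: t_act_def)

text \<open>When the inner step deletes a letter, reducedness of \<open>n\<close> ensures that
  putting it back does not cause a new cancellation.\<close>

lemma t_act_t_act: "reduced_nf n \<Longrightarrow> t_act e (t_act (\<not> e) n) = n"
  by (cases n) (auto simp: t_act_def)

text \<open>The relation x t = t y on normal forms. In the cancelling case the first coset is
  trivial, so the whole of \<open>sub (\<not> e) m\<close> is carried across the deleted letter and
  reaches the tail as \<open>sub e m\<close>.\<close>

lemma t_act_commute:
  assumes "reduced_nf n"
  shows "base_act (sub e m) (t_act e n) = t_act e (base_act (sub (\<not> e) m) n)"
proof (cases "cancels e n")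
  case True
  then show ?thesis using assms cancels_base_act[OF assms, of e m]
    by (cases n) (auto simp: t_act_def)
next
  case False
  then show ?thesis using cancels_base_act[OF assms, of e m]
    by (simp add: t_act_def)
qed

lemma nf_length_base_act [simp]: "nf_length (base_act p n) = nf_length n"
  by (induction n arbitrary: p) simp_all

lemma nf_length_t_act: "nf_length (t_act e n) \<le> Suc (nf_length n)"
  by (cases n) (auto simp: t_act_def)

section \<open>Actions of presented groups\<close>

definition word_act :: "('g \<Rightarrow> bool \<Rightarrow> 'n \<Rightarrow> 'n) \<Rightarrow> 'g word \<Rightarrow> 'n \<Rightarrow> 'n" where
  "word_act s w n = foldr (\<lambda>(g, e). s g e) w n"

lemma word_act_simps [simp]:
  "word_act s [] n = n"
  "word_act s ((g, e) # w) n = s g e (word_act s w n)"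
  "word_act s (u @ v) n = word_act s u (word_act s v n)"
  by (simp_all add: word_act_def)

text \<open>The set \<open>S\<close> is a parameter because the letters act by mutually inverse maps
  only on reduced normal forms.\<close>

lemma word_act_eq:
  assumes closed: "\<And>g e n. n \<in> S \<Longrightarrow> s g e n \<in> S"
    and inverse: "\<And>g e n. n \<in> S \<Longrightarrow> s g e (s g (\<not> e) n) = n"
    and rels: "\<And>l r n. (l, r) \<in> R \<Longrightarrow> n \<in> S \<Longrightarrow> word_act s l n = word_act s r n"
  shows "word_eq R v w \<Longrightarrow> n \<in> S \<Longrightarrow> word_act s v n = word_act s w n"
proof (induction arbitrary: n rule: word_eq.induct)
  have mem: "word_act s w n \<in> S" if "n \<in> S" for w n
    using that by (induction w) (auto intro: closed)
  case (cancel u g e v)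
  show ?case using inverse[OF mem[OF cancel]] by simp
next
  have mem: "word_act s w n \<in> S" if "n \<in> S" for w n
    using that by (induction w) (auto intro: closed)
  case (rel l r u v)
  then show ?case using rels mem by simp
qed auto

section \<open>The Baumslag-Gersten group as a type\<close>

definition bg_rels :: "(bg_gen word \<times> bg_gen word) set" where
  "bg_rels = {(conj_word (gen_word BG_x) (gen_word BG_y), gen_word BG_x @ gen_word BG_x),
    (conj_word (gen_word BG_x) (gen_word BG_t), gen_word BG_y)}"

lemma baumslag_gersten_eq: "baumslag_gersten = presented_group bg_rels"
  by (simp add: baumslag_gersten_def bg_rels_def Let_def)

interpretation BG: group baumslag_gersten
  unfolding baumslag_gersten_eq by (rule group_presented_group)

text \<open>As a type the group can instantiate \<open>group_add\<close>, so the group laws hold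
  without membership side conditions.\<close>

typedef bg = "carrier baumslag_gersten"
  using BG.one_closed by blast

instantiation bg :: group_add
begin

definition "0 = Abs_bg \<one>\<^bsub>baumslag_gersten\<^esub>"

definition "a + b = Abs_bg (Rep_bg a \<otimes>\<^bsub>baumslag_gersten\<^esub> Rep_bg b)"

definition "- a = Abs_bg (inv\<^bsub>baumslag_gersten\<^esub> Rep_bg a)"

definition "a - b = a + - (b::bg)"

instance
proof
  fix a b c :: bg
  show "a + b + c = a + (b + c)"
    using Rep_bg[of a] Rep_bg[of b] Rep_bg[of c]
    by (simp add: plus_bg_def Abs_bg_inverse BG.m_assoc)
  show "0 + a = a" "a + 0 = a"
    using Rep_bg[of a] by (simp_all add: plus_bg_def zero_bg_def Abs_bg_inverse Rep_bg_inverse)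
  show "- a + a = 0"
    using Rep_bg[of a] by (simp add: plus_bg_def zero_bg_def uminus_bg_def Abs_bg_inverse)
  show "a + - b = a - b"
    by (simp add: minus_bg_def)
qed

end

definition cls :: "bg_gen word \<Rightarrow> bg" where
  "cls w = Abs_bg (word_class bg_rels w)"

definition gen :: "bg_gen \<Rightarrow> bg" where
  "gen g = cls [(g, True)]"

abbreviation "gx \<equiv> gen BG_x"
abbreviation "gy \<equiv> gen BG_y"
abbreviation "gt \<equiv> gen BG_t"

definition signed :: "bool \<Rightarrow> 'a::group_add \<Rightarrow> 'a" where
  "signed e a = (if e then a else - a)"

lemma word_class_mem: "word_class bg_rels w \<in> carrier baumslag_gersten"
  by (simp add: baumslag_gersten_eq carrier_presented_group)

lemma cls_eq_iff: "cls v = cls w \<longleftrightarrow> word_eq bg_rels v w"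
  by (simp add: cls_def Abs_bg_inject word_class_mem word_class_eq_iff)

lemma cls_append: "cls (u @ v) = cls u + cls v"
proof -
  have "Rep_bg (cls w) = word_class bg_rels w" for w
    by (simp add: cls_def Abs_bg_inverse word_class_mem)
  then show ?thesis
    by (simp add: cls_def plus_bg_def baumslag_gersten_eq mult_presented_group)
qed

lemma cls_Nil: "cls [] = 0"
  by (simp add: cls_def zero_bg_def baumslag_gersten_eq one_presented_group)

lemma ex_cls: "\<exists>w. cls w = a"
proof (cases a)
  case (Abs_bg A)
  then show ?thesis
    by (auto simp: cls_def baumslag_gersten_eq carrier_presented_group)
qed

lemma cls_letter: "cls [(g, e)] = signed e (gen g)"
proof (cases e)
  case False
  have "word_eq bg_rels ([] @ [(g, False), (g, \<not> False)] @ []) ([] @ [])"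
    by (rule word_eq.cancel)
  then have "cls ([(g, False)] @ [(g, True)]) = cls []"
    by (simp add: cls_eq_iff)
  then have "cls [(g, False)] = - gen g"
    unfolding cls_append cls_Nil gen_def by (simp add: eq_neg_iff_add_eq_0)
  then show ?thesis using False by (simp add: signed_def)
qed (simp add: gen_def signed_def)

lemma cls_Cons: "cls ((g, e) # w) = signed e (gen g) + cls w"
  using cls_append[of "[(g, e)]" w] by (simp add: cls_letter)

lemma bg_rel_xy: "- gy + gx + gy = gx + gx"
proof -
  have "cls (conj_word (gen_word BG_x) (gen_word BG_y)) = cls (gen_word BG_x @ gen_word BG_x)"
    unfolding cls_eq_iff using word_eq.rel[of _ _ bg_rels "[]" "[]"] by (simp add: bg_rels_def)
  then show ?thesis
    by (simp add: conj_word_def inv_word_def gen_word_def cls_Cons cls_Nil signed_def add.assoc)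
qed

lemma bg_rel_xt: "- gt + gx + gt = gy"
proof -
  have "cls (conj_word (gen_word BG_x) (gen_word BG_t)) = cls (gen_word BG_y)"
    unfolding cls_eq_iff using word_eq.rel[of _ _ bg_rels "[]" "[]"] by (simp add: bg_rels_def)
  then show ?thesis
    by (simp add: conj_word_def inv_word_def gen_word_def cls_Cons cls_Nil signed_def add.assoc)
qed

lemma bg_induct [case_names zero letter]:
  assumes "P 0" and "\<And>g e a. P a \<Longrightarrow> P (signed e (gen g) + a)"
  shows "P a"
proof -
  have "P (cls w)" for w
    by (induction w) (use assms in \<open>auto simp: cls_Nil cls_Cons\<close>)
  then show ?thesis using ex_cls by metis
qed

text \<open>Von Dyck's theorem: every letter acts on the target group by left translation, and a
  word is evaluated by applying it to 0.\<close>

lemma bg_universal: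
  fixes \<phi> :: "bg_gen \<Rightarrow> 'a::group_add"
  assumes xy: "- \<phi> BG_y + \<phi> BG_x + \<phi> BG_y = \<phi> BG_x + \<phi> BG_x"
    and xt: "- \<phi> BG_t + \<phi> BG_x + \<phi> BG_t = \<phi> BG_y"
  obtains f where "additive_map f" and "\<And>g. f (gen g) = \<phi> g"
proof -
  define s where "s g e n = signed e (\<phi> g) + n" for g e n
  define f where "f a = word_act s (SOME w. cls w = a) 0" for a
  \<comment> \<open>Left translations commute with right translations; this is what makes
    \<open>f\<close> additive.\<close>
  have shift: "word_act s w n = word_act s w 0 + n" for w n
    by (induction w) (auto simp: s_def add.assoc)
  have eq: "word_act s v n = word_act s w n" if "word_eq bg_rels v w" for v w n
  proof (rule word_act_eq[OF _ _ _ that, of UNIV])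
    fix l r n
    assume "(l, r) \<in> bg_rels"
    then consider "l = conj_word (gen_word BG_x) (gen_word BG_y)" "r = gen_word BG_x @ gen_word BG_x"
      | "l = conj_word (gen_word BG_x) (gen_word BG_t)" "r = gen_word BG_y"
      by (auto simp: bg_rels_def)
    then show "word_act s l n = word_act s r n"
    proof cases
      case 1
      have "- \<phi> BG_y + (\<phi> BG_x + (\<phi> BG_y + n)) = \<phi> BG_x + (\<phi> BG_x + n)"
        using xy by (metis add.assoc)
      then show ?thesis
        by (simp add: 1 conj_word_def inv_word_def gen_word_def s_def signed_def)
    next
      case 2
      have "- \<phi> BG_t + (\<phi> BG_x + (\<phi> BG_t + n)) = \<phi> BG_y + n"
        using xt by (metis add.assoc)
      then show ?thesis
        by (simp add: 2 conj_word_def inv_word_def gen_word_def s_def signed_def)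
    qed
  qed (auto simp: s_def signed_def)
  have f_cls: "f (cls w) = word_act s w 0" for w
  proof -
    have "cls (SOME v. cls v = cls w) = cls w" by (rule someI) simp
    then show ?thesis unfolding f_def by (intro eq) (simp add: cls_eq_iff)
  qed
  show thesis
  proof
    show "additive_map f"
    proof
      fix a b
      obtain u v where "a = cls u" "b = cls v" using ex_cls by metis
      then show "f (a + b) = f a + f b"
        by (simp add: f_cls flip: cls_append) (rule shift)
    qed
    show "f (gen g) = \<phi> g" for g
      by (simp add: gen_def f_cls s_def signed_def)
  qed
qed

lemma additive_map_id:
  assumes "additive_map f" "\<And>g. f (gen g) = gen g"
  shows "f a = a"
proof -
  interpret additive_map f by fact
  show ?thesis
    by (induction a rule: bg_induct) (auto simp: add minus signed_def assms)
qed

subsection \<open>The action on normal forms\<close>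

fun nf_letter :: "bg_gen \<Rightarrow> bool \<Rightarrow> nf \<Rightarrow> nf" where
  "nf_letter BG_x e n = base_act (signed e (sub True 1)) n"
| "nf_letter BG_y e n = base_act (signed e (sub False 1)) n"
| "nf_letter BG_t e n = t_act e n"

lemma nf_letter_word_eq:
  assumes "word_eq bg_rels v w" "reduced_nf n"
  shows "word_act nf_letter v n = word_act nf_letter w n"
proof (rule word_act_eq[OF _ _ _ assms(1), of "{n. reduced_nf n}"])
  fix g e n
  assume "n \<in> {n. reduced_nf n}"
  then show "nf_letter g e n \<in> {n. reduced_nf n}"
    by (cases g) (simp_all add: reduced_base_act reduced_t_act)
next
  fix g e n
  assume "n \<in> {n. reduced_nf n}"
  then show "nf_letter g e (nf_letter g (\<not> e) n) = n"
    by (cases g) (simp_all add: t_act_t_act base_act_0 signed_def del: sub.simps flip: base_act_add)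
next
  fix l r n
  assume lr: "(l, r) \<in> bg_rels" and "n \<in> {n. reduced_nf n}"
  then have n: "reduced_nf n" by simp
  from lr consider "l = conj_word (gen_word BG_x) (gen_word BG_y)" "r = gen_word BG_x @ gen_word BG_x"
    | "l = conj_word (gen_word BG_x) (gen_word BG_t)" "r = gen_word BG_y"
    by (auto simp: bg_rels_def)
  then show "word_act nf_letter l n = word_act nf_letter r n"
  proof cases
    case 1
    have "- sub False 1 + (sub True 1 + sub False 1) = sub True 1 + sub True 1" by simp
    then show ?thesis
      by (simp add: 1 conj_word_def inv_word_def gen_word_def signed_def
          del: sub.simps flip: base_act_add)
  next
    case 2
    have "base_act (sub True 1) (t_act True n) = t_act True (base_act (sub False 1) n)"
      using t_act_commute[OF n, of True 1] by simp
    then show ?thesis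
      using t_act_t_act[OF reduced_base_act[OF n], of False]
      by (simp add: 2 conj_word_def inv_word_def gen_word_def signed_def del: sub.simps)
  qed
qed (use assms in simp)

definition nf_act :: "bg \<Rightarrow> nf \<Rightarrow> nf" where
  "nf_act a n = word_act nf_letter (SOME w. cls w = a) n"

lemma nf_act_cls: "nf_act (cls w) n = word_act nf_letter w n" if "reduced_nf n"
proof -
  have "cls (SOME v. cls v = cls w) = cls w" by (rule someI) simp
  then show ?thesis
    unfolding nf_act_def by (intro nf_letter_word_eq that) (simp add: cls_eq_iff)
qed

lemma reduced_word_act: "reduced_nf n \<Longrightarrow> reduced_nf (word_act nf_letter w n)"
proof (induction w)
  case (Cons l w)
  obtain g e where "l = (g, e)" by fastforce
  with Cons show ?case by (cases g) (simp_all add: reduced_base_act reduced_t_act)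
qed simp

lemma reduced_nf_act: "reduced_nf n \<Longrightarrow> reduced_nf (nf_act a n)"
  by (simp add: nf_act_def reduced_word_act)

lemma nf_act_add: "reduced_nf n \<Longrightarrow> nf_act (a + b) n = nf_act a (nf_act b n)"
  using ex_cls[of a] ex_cls[of b]
  by (auto simp: nf_act_cls reduced_word_act simp flip: cls_append)

lemma nf_act_0: "reduced_nf n \<Longrightarrow> nf_act 0 n = n"
  by (simp add: nf_act_cls flip: cls_Nil)

lemma nf_act_letter: "reduced_nf n \<Longrightarrow> nf_act (signed e (gen g)) n = nf_letter g e n"
  by (simp add: nf_act_cls flip: cls_letter)

text \<open>Each letter adds at most one edge. The bound is uniform in \<open>n\<close>, as the
  later comparison of linear with exponential growth requires.\<close>

lemma nf_act_bounded: "\<exists>C. \<forall>n. reduced_nf n \<longrightarrow> nf_length (nf_act a n) \<le> nf_length n + C"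
proof (induction a rule: bg_induct)
  case zero
  show ?case by (auto simp: nf_act_0)
next
  case (letter g e a)
  then obtain C where C: "reduced_nf n \<Longrightarrow> nf_length (nf_act a n) \<le> nf_length n + C" for n
    by blast
  have "nf_length (nf_letter g e n) \<le> Suc (nf_length n)" for n
    by (cases g) (simp_all add: nf_length_t_act)
  then have "nf_length (nf_act (signed e (gen g) + a) n) \<le> nf_length n + Suc C" if "reduced_nf n" for n
    using C[OF that] that
    by (simp add: nf_act_add nf_act_letter reduced_nf_act) (meson Suc_le_mono le_trans)
  then show ?case by blast
qed

subsection \<open>The base group\<close>

definition assoc_gen :: "bool \<Rightarrow> bg" where
  "assoc_gen e = (if e then gx else gy)"

text \<open>The subgroup generated by x and y, given by the explicit form y^i x^m y^(-j) with
  natural \<open>i\<close> and \<open>j\<close>, from which the image in the affine group can be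
  read off.\<close>

definition base :: "bg set" where
  "base = {zmul (int i) gy + zmul m gx - zmul (int j) gy | i m j. True}"

lemma zmul_x_y: "zmul m gx + gy = gy + zmul (2 * m) gx"
proof -
  have "- gy + zmul m gx + gy = zmul m (zmul 2 gx)"
    using zmul_add[of 1 1 gx] by (simp add: bg_rel_xy flip: zmul_conj)
  then show ?thesis by (metis add.assoc add_minus_cancel zmul_zmul)
qed

lemma zmul_x_zmul_y: "zmul n gx + zmul (int i) gy = zmul (int i) gy + zmul (n * 2 ^ i) gx"
proof (induction i)
  case (Suc i)
  have "zmul n gx + zmul (int (Suc i)) gy = zmul n gx + zmul (int i) gy + gy"
    using zmul_add_1[of "int i" gy] by (simp add: add.assoc add.commute)
  also have "\<dots> = zmul (int i) gy + gy + zmul (2 * (n * 2 ^ i)) gx"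
    by (simp add: Suc add.assoc zmul_x_y)
  finally show ?case
    using zmul_add_1[of "int i" gy] by (simp add: add.commute ac_simps)
qed simp

lemma baseI: "zmul (int i) gy + zmul m gx - zmul (int j) gy \<in> base"
  unfolding base_def by blast

lemma base_0: "0 \<in> base"
  using baseI[of 0 0 0] by simp

lemma base_minus: "b \<in> base \<Longrightarrow> - b \<in> base"
proof -
  assume "b \<in> base"
  then obtain i m j where b: "b = zmul (int i) gy + zmul m gx - zmul (int j) gy"
    unfolding base_def by blast
  have "- b = zmul (int j) gy + zmul (- m) gx - zmul (int i) gy"
    by (simp add: b diff_conv_add_uminus minus_add zmul_minus add.assoc del: add_uminus_conv_diff)
  then show ?thesis using baseI by simp
qed

lemma base_zmul_x_add: "b \<in> base \<Longrightarrow> zmul n gx + b \<in> base"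
proof -
  assume "b \<in> base"
  then obtain i m j where b: "b = zmul (int i) gy + zmul m gx - zmul (int j) gy"
    unfolding base_def by blast
  have "zmul n gx + b = (zmul n gx + zmul (int i) gy) + zmul m gx - zmul (int j) gy"
    by (simp add: b add_diff_eq add.assoc)
  also have "\<dots> = zmul (int i) gy + zmul (n * 2 ^ i + m) gx - zmul (int j) gy"
    by (simp add: zmul_x_zmul_y zmul_add add.assoc)
  finally show ?thesis using baseI by simp
qed

text \<open>The inverse of y lowers \<open>i\<close> if it can; for \<open>i = 0\<close> it passes
  through x^m, doubling \<open>m\<close>, and raises \<open>j\<close>.\<close>

lemma base_y_add: "b \<in> base \<Longrightarrow> gy + b \<in> base" "b \<in> base \<Longrightarrow> - gy + b \<in> base"
proof -
  assume "b \<in> base"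
  then obtain i m j where b: "b = zmul (int i) gy + zmul m gx - zmul (int j) gy"
    unfolding base_def by blast
  have Suc: "zmul (int (Suc i)) gy = gy + zmul (int i) gy" for i
    using zmul_add[of 1 "int i" gy] by simp
  have "gy + b = zmul (int (Suc i)) gy + zmul m gx - zmul (int j) gy"
    unfolding Suc by (simp add: b add_diff_eq add.assoc)
  then show "gy + b \<in> base" using baseI by metis
  show "- gy + b \<in> base"
  proof (cases i)
    case 0
    have "- gy + zmul m gx = zmul (2 * m) gx - gy"
      by (metis add.assoc add_minus_cancel minus_add_cancel zmul_x_y eq_diff_eq)
    then have "- gy + b = zmul (2 * m) gx - gy - zmul (int j) gy"
      by (simp add: b 0 add_diff_eq)
    also have "\<dots> = zmul (int 0) gy + zmul (2 * m) gx - zmul (int (Suc j)) gy"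
      using zmul_add_1[of "int j" gy] by (simp add: diff_diff_eq2 add.commute minus_add diff_conv_add_uminus add.assoc del: add_uminus_conv_diff)
    finally show ?thesis using baseI by metis
  next
    case (Suc k)
    then have "- gy + b = zmul (int k) gy + zmul m gx - zmul (int j) gy"
      unfolding b Suc \<open>\<And>i. zmul (int (Suc i)) gy = _\<close> by (simp add: add_diff_eq add.assoc flip: add_diff_eq)
    then show ?thesis using baseI by simp
  qed
qed

lemma base_zmul_y_add: "b \<in> base \<Longrightarrow> zmul n gy + b \<in> base"
proof (induction n arbitrary: b rule: int_induct[where k = 0])
  case (step2 i)
  have "zmul (i - 1) gy + b = zmul i gy + (- gy + b)"
    by (simp add: zmul_diff_1 add.assoc diff_conv_add_uminus[of "zmul i gy"]
        del: add_uminus_conv_diff)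
  then show ?case using step2 by (simp add: base_y_add)
qed (simp_all add: zmul_add_1 add.assoc base_y_add)

lemma base_add: "a \<in> base \<Longrightarrow> b \<in> base \<Longrightarrow> a + b \<in> base"
proof -
  assume "a \<in> base" and b: "b \<in> base"
  then obtain i m j where a: "a = zmul (int i) gy + zmul m gx - zmul (int j) gy"
    unfolding base_def by blast
  have "a + b = zmul (int i) gy + (zmul m gx + (zmul (- int j) gy + b))"
    by (simp add: a zmul_minus add.assoc diff_conv_add_uminus del: add_uminus_conv_diff)
  then show ?thesis using b by (simp add: base_zmul_x_add base_zmul_y_add)
qed

lemma base_diff: "a \<in> base \<Longrightarrow> b \<in> base \<Longrightarrow> a - b \<in> base"
  using base_add[OF _ base_minus] by simp

lemma base_zmul: "zmul m (assoc_gen e) \<in> base"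
  using base_zmul_x_add[OF base_0, of m] base_zmul_y_add[OF base_0, of m]
  by (simp add: assoc_gen_def)

lemma base_gen: "gx \<in> base" "gy \<in> base"
  using base_zmul[of 1 True] base_zmul[of 1 False] by (simp_all add: assoc_gen_def)

lemma nf_act_zmul:
  "reduced_nf n \<Longrightarrow> nf_act (zmul m (assoc_gen e)) n = base_act (sub e m) n"
proof (induction m arbitrary: n rule: int_induct[where k = 0])
  case base
  then show ?case by (simp add: nf_act_0 base_act_0)
next
  case (step1 i)
  have "nf_act (assoc_gen e) n = base_act (sub e 1) n"
    using step1.prems nf_act_letter[of n True BG_x] nf_act_letter[of n True BG_y]
    by (cases e) (simp_all add: assoc_gen_def signed_def)
  then show ?case using step1
    by (simp add: zmul_add_1 nf_act_add reduced_base_act sub_add base_act_add del: sub.simps)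
next
  case (step2 i)
  have "nf_act (- assoc_gen e) n = base_act (sub e (- 1)) n"
    using step2.prems nf_act_letter[of n False BG_x] nf_act_letter[of n False BG_y]
    by (cases e) (simp_all add: assoc_gen_def signed_def)
  moreover have "zmul (i - 1) (assoc_gen e) = zmul i (assoc_gen e) + - assoc_gen e"
    by (simp add: zmul_diff_1)
  moreover have "sub e (i - 1) = sub e i + sub e (- 1)"
    by (simp del: sub.simps flip: sub_add)
  ultimately show ?case using step2
    by (simp add: nf_act_add reduced_base_act base_act_add del: sub.simps add_uminus_conv_diff)
qed

text \<open>On \<open>base\<close> this is the embedding into the affine group, read off from the
  action on the trivial normal form.\<close>

definition rho :: "bg \<Rightarrow> aff" where
  "rho b = (THE p. nf_act b (Base 0) = Base p)"

lemma rhoI: "(\<And>n. reduced_nf n \<Longrightarrow> nf_act b n = base_act p n) \<Longrightarrow> rho b = p"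
  by (simp add: rho_def)

lemma nf_act_base_form:
  assumes "reduced_nf n"
  shows "nf_act (zmul i gy + zmul m gx - zmul j gy) n =
    base_act (sub False i + sub True m - sub False j) n"
proof -
  have "zmul i gy + zmul m gx - zmul j gy =
      zmul i (assoc_gen False) + zmul m (assoc_gen True) + zmul (- j) (assoc_gen False)"
    by (simp add: assoc_gen_def zmul_minus)
  moreover have "sub False i + sub True m - sub False j
      = sub False i + sub True m + sub False (- j)"
    by (simp add: diff_conv_add_uminus sub_minus del: add_uminus_conv_diff sub.simps)
  ultimately show ?thesis using assms
    by (simp add: nf_act_add nf_act_zmul reduced_base_act base_act_add del: sub.simps)
qed

lemma nf_act_base: "b \<in> base \<Longrightarrow> reduced_nf n \<Longrightarrow> nf_act b n = base_act (rho b) n"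
proof -
  assume "b \<in> base" and n: "reduced_nf n"
  then obtain i m j where b: "b = zmul (int i) gy + zmul m gx - zmul (int j) gy"
    unfolding base_def by blast
  show ?thesis
    unfolding b using rhoI[OF nf_act_base_form] nf_act_base_form n by metis
qed

lemma rho_add: "a \<in> base \<Longrightarrow> b \<in> base \<Longrightarrow> rho (a + b) = rho a + rho b"
  by (rule rhoI) (simp add: nf_act_add nf_act_base reduced_base_act base_act_add)

lemma rho_0 [simp]: "rho 0 = 0"
  by (rule rhoI) (simp add: nf_act_0 base_act_0)

lemma rho_minus: "a \<in> base \<Longrightarrow> rho (- a) = - rho a"
  using rho_add[of "- a" a] by (simp add: base_minus eq_neg_iff_add_eq_0)

lemma rho_zmul: "rho (zmul m (assoc_gen e)) = sub e m"
  by (rule rhoI) (rule nf_act_zmul)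

lemma rho_gen: "rho gx = Aff 1 0" "rho gy = Aff 0 1"
  using rho_zmul[of 1 True] rho_zmul[of 1 False] by (simp_all add: assoc_gen_def)

text \<open>The element y^i x^m y^(-j) maps to \<open>Aff (2 powi (- i) * m) (i - j)\<close>, which
  is trivial only for \<open>m = 0\<close> and \<open>i = j\<close>. Equations in
  \<open>base\<close> can thus be checked in coordinates.\<close>

lemma rho_inj:
  assumes "a \<in> base" "b \<in> base" "rho a = rho b"
  shows "a = b"
proof -
  have "a - b \<in> base" using assms base_diff by blast
  then obtain i m j where ab: "a - b = zmul (int i) gy + zmul m gx - zmul (int j) gy"
    unfolding base_def by blast
  have "rho (a - b) = 0"
    using rho_add[OF assms(1) base_minus[OF assms(2)]] by (simp add: rho_minus assms)
  then have "sub False (int i) + sub True m - sub False (int j) = 0"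
    unfolding ab using rhoI[OF nf_act_base_form] by metis
  then have "i = j" "m = 0"
    by (auto simp: zero_aff_def minus_aff_def)
  then show ?thesis using ab by simp
qed

lemma rho_eq_sub: "b \<in> base \<Longrightarrow> rho b = sub e m \<Longrightarrow> b = zmul m (assoc_gen e)"
  using rho_inj[OF _ base_zmul] rho_zmul by metis

subsection \<open>Britton's lemma\<close>

text \<open>The rule that removes two opposite letters from a word: t y^m t^(-1) = x^m and t^(-1)
  x^m t = y^m.\<close>

lemma pinch: "signed e gt + zmul m (assoc_gen (\<not> e)) + signed (\<not> e) gt = zmul m (assoc_gen e)"
proof (cases e)
  case True
  have "gx = gt + gy + - gt"
    by (simp add: add.assoc flip: bg_rel_xt del: add_uminus_conv_diff)
  then show ?thesis
    using zmul_conj[of m "- gt" gy] True by (simp add: assoc_gen_def signed_def)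
next
  case False
  then show ?thesis
    using zmul_conj[of m gt gx] by (simp add: assoc_gen_def signed_def bg_rel_xt)
qed

lemma zmul_x_t: "zmul m gx + gt = gt + zmul m gy"
proof -
  have "gt + (- gt + zmul m gx + gt) = gt + zmul m gy"
    using pinch[of False m] by (simp add: assoc_gen_def signed_def)
  then show ?thesis by (simp add: add.assoc)
qed

section \<open>Words in syllables and their reduced forms\<close>

fun syllables :: "(bool \<times> bg) list \<Rightarrow> bg" where
  "syllables [] = 0"
| "syllables ((e, b) # W) = signed e gt + b + syllables W"

text \<open>Britton's condition, phrased as a relation between neighbouring syllables so that
  \<open>successively\<close> applies.\<close>

definition no_pinch :: "bool \<times> bg \<Rightarrow> bool \<times> bg \<Rightarrow> bool" where
  "no_pinch s s' \<longleftrightarrow> \<not> (fst s' = (\<not> fst s) \<and> snd s \<in> range (\<lambda>m. zmul m (assoc_gen (fst s'))))"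

definition over_base :: "(bool \<times> bg) list \<Rightarrow> bool" where
  "over_base W \<longleftrightarrow> snd ` set W \<subseteq> base"

definition reduced :: "(bool \<times> bg) list \<Rightarrow> bool" where
  "reduced W \<longleftrightarrow> over_base W \<and> successively no_pinch W"

lemma syllables_append: "syllables (U @ V) = syllables U + syllables V"
  by (induction U rule: syllables.induct) (simp_all add: add.assoc)

lemma reduced_ConsD: "reduced (s # W) \<Longrightarrow> snd s \<in> base \<and> reduced W"
  by (auto simp: reduced_def over_base_def successively_Cons)

text \<open>A new letter on the left can create a pinch only with the first syllable; removing that
  pinch leaves an element of \<open>base\<close> in front of a shorter reduced word.\<close>

lemma ex_reduced: "\<exists>b W. b \<in> base \<and> reduced W \<and> g = b + syllables W"
proof (induction g rule: bg_induct)
  case zero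
  show ?case using base_0 by (intro exI[of _ 0] exI[of _ "[]"]) (simp add: reduced_def over_base_def)
next
  case (letter l e g)
  then obtain b W where b: "b \<in> base" and W: "reduced W" and g: "g = b + syllables W"
    by blast
  show ?case
  proof (cases "l = BG_t")
    case False
    then have "signed e (gen l) \<in> base"
      using base_gen base_minus by (cases l) (auto simp: signed_def)
    then show ?thesis using b W g by (metis add.assoc base_add)
  next
    case l: True
    show ?thesis
    proof (cases "W \<noteq> [] \<and> \<not> no_pinch (e, b) (hd W)")
      case True
      then obtain s W' where sW': "W = s # W'" by (cases W) auto
      have s: "fst s = (\<not> e)" and "b \<in> range (\<lambda>m. zmul m (assoc_gen (fst s)))"
        using True by (auto simp add: no_pinch_def sW' simp del: Product_Type.split_paired_Ex)
      then obtain m where m: "b = zmul m (assoc_gen (\<not> e))" by auto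
      obtain b' where W': "W = (\<not> e, b') # W'" using s sW' by (cases s) auto
      have "signed e (gen l) + g
          = signed e gt + zmul m (assoc_gen (\<not> e)) + signed (\<not> e) gt + b' + syllables W'"
        by (simp add: l g W' m add.assoc)
      also have "\<dots> = zmul m (assoc_gen e) + b' + syllables W'"
        by (simp only: pinch)
      finally show ?thesis
        using reduced_ConsD[OF W[unfolded W']] base_add[OF base_zmul] by (metis snd_conv)
    next
      case False
      then have "reduced ((e, b) # W)"
        using b W by (auto simp: reduced_def over_base_def successively_Cons)
      then show ?thesis using base_0
        by (intro exI[of _ 0] exI[of _ "(e, b) # W"]) (simp add: l g add.assoc)
    qed
  qed
qed

text \<open>Every syllable adds exactly one edge: a cancellation would put \<open>rho b\<close> into
  the associated subgroup, and injectivity of \<open>rho\<close> would turn this into a pinch. The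
  trivial first coset is recorded for the induction.\<close>

lemma nf_act_syllables:
  assumes "reduced W"
  shows "nf_length (nf_act (syllables W) (Base p)) = length W \<and>
    (case W of [] \<Rightarrow> nf_act (syllables W) (Base p) = Base p
     | s # W' \<Rightarrow> \<exists>n. nf_act (syllables W) (Base p) = Edge 0 (fst s) n)"
  using assms
proof (induction W)
  case Nil
  show ?case by (simp add: nf_act_0)
next
  case (Cons s W)
  obtain e b where s: "s = (e, b)" by fastforce
  have b: "b \<in> base" and W: "reduced W" using reduced_ConsD[OF Cons.prems] s by auto
  define n where "n = nf_act (syllables W) (Base p)"
  have n: "reduced_nf n" by (simp add: n_def reduced_nf_act)
  have act: "nf_act (syllables (s # W)) (Base p) = t_act e (base_act (rho b) n)"
    using nf_act_letter[of _ e BG_t]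
    by (simp add: s nf_act_add reduced_nf_act nf_act_base b reduced_base_act n flip: n_def)
  have "\<not> cancels e (base_act (rho b) n)"
  proof (cases W)
    case Nil
    then show ?thesis using Cons.IH[OF W] by (simp add: n_def)
  next
    case (Cons s' W')
    then obtain n' where n': "n = Edge 0 (fst s') n'"
      using Cons.IH[OF W] by (auto simp: n_def)
    show ?thesis
    proof
      assume "cancels e (base_act (rho b) n)"
      then have e: "fst s' = (\<not> e)" and "rep (\<not> e) (rho b) = rep (\<not> e) 0"
        by (auto simp: n')
      then obtain m where "rho b = sub (\<not> e) m"
        using rep_eq_imp_sub[of "\<not> e" "rho b" 0] by auto
      then have "b = zmul m (assoc_gen (\<not> e))" by (rule rho_eq_sub[OF b])
      then show False
        using Cons.prems e by (auto simp: reduced_def no_pinch_def s Cons)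
    qed
  qed
  then show ?case
    using Cons.IH[OF W] unfolding act by (simp add: t_act_def s flip: n_def)
qed

text \<open>Both sides of \<open>eq\<close> act on the trivial normal form, and the cosets of the
  first edges are compared: \<open>a + b\<close> and \<open>b\<close> must lie in the same coset of
  the associated subgroup.\<close>

lemma britton:
  assumes a: "a \<in> base" "a' \<in> base" and b: "b \<in> base" and W: "reduced ((e, c) # W)"
    and g: "g = b + syllables ((e, c) # W)" and eq: "a + g = g + a'"
  shows "\<exists>m. - b + a + b = zmul m (assoc_gen e)"
proof -
  have head: "\<exists>n. nf_act (u + syllables ((e, c) # W)) (Base p) = Edge (rep e (rho u)) e n"
    if u: "u \<in> base" for u p
  proof -
    obtain n where n: "nf_act (syllables ((e, c) # W)) (Base p) = Edge 0 e n"
      using nf_act_syllables[OF W, of p] by auto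
    have "reduced_nf (Edge 0 e n)"
      using reduced_nf_act[of "Base p" "syllables ((e, c) # W)"] n by simp
    then show ?thesis using u n by (simp add: nf_act_add nf_act_base del: syllables.simps)
  qed
  \<comment> \<open>The right factor \<open>a'\<close> acts first and only changes the starting
    point, on which the first edge does not depend.\<close>
  have "nf_act (a + b + syllables ((e, c) # W)) (Base 0)
      = nf_act (b + syllables ((e, c) # W)) (Base (rho a'))"
    using eq nf_act_add[of "Base 0" g a'] by (simp add: g add.assoc nf_act_base a)
  then have "rep e (rho (a + b)) = rep e (rho b)"
    using head[OF base_add[OF a(1) b], of 0] head[OF b, of "rho a'"] by auto
  then obtain m where "- rho b + rho (a + b) = sub e m"
    using rep_eq_imp_sub by blast
  then have "rho (- b + (a + b)) = sub e m"
    using a b by (simp add: rho_add rho_minus base_add base_minus)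
  then have "- b + (a + b) = zmul m (assoc_gen e)"
    using a b by (intro rho_eq_sub) (simp_all add: base_add base_minus)
  then show ?thesis by (auto simp: add.assoc)
qed

section \<open>Conjugacy in the Baumslag-Gersten group\<close>

lemma powi_eq_1D: "(2::rat) powi k = 1 \<Longrightarrow> k = 0"
  using power_int_strict_increasing[of 0 k "2::rat"] power_int_strict_increasing[of k 0 "2::rat"]
  by (cases k "0::int" rule: linorder_cases) auto

lemma ex_exp_gt_linear: "\<exists>k. C + k * D < (2::nat) ^ k"
proof -
  \<comment> \<open>The witness for \<open>k\<close> is \<open>j + j\<close>: the square of
    \<open>2 ^ j\<close> is at least the square of \<open>j + 1\<close>.\<close>
  define j where "j = 2 * D + C"
  have "C + (j + j) * D < (j + 1) * (j + 1)"
    by (simp add: j_def algebra_simps)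
  also have "\<dots> \<le> 2 ^ j * 2 ^ j"
    using less_exp[of j] by (intro mult_le_mono) (simp_all only: Suc_eq_plus1[symmetric] Suc_le_eq)
  finally show ?thesis by (auto simp: power_add[symmetric])
qed

text \<open>If \<open>g\<close> had letters, the first would be t, since no element of
  \<open>base\<close> conjugates x^m to a power of y. The rest \<open>h\<close> then conjugates a
  nontrivial power of y to a power of x. This is impossible inside \<open>base\<close>, and a
  further letter would have to be t^(-1) after a power of y, a pinch.\<close>

lemma normalizes_x_imp_base:
  assumes m: "m \<noteq> 0" and eq: "zmul m gx + g = g + zmul n gx"
  shows "g \<in> base"
proof -
  obtain b W where b: "b \<in> base" and W: "reduced W" and g: "g = b + syllables W"
    using ex_reduced by blast
  have x: "zmul k gx \<in> base" "rho (zmul k gx) = Aff (of_int k) 0" for k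
    using base_zmul[of k True] rho_zmul[of k True] by (simp_all add: assoc_gen_def)
  have y: "zmul k gy \<in> base" "rho (zmul k gy) = Aff 0 k" for k
    using base_zmul[of k False] rho_zmul[of k False] by (simp_all add: assoc_gen_def)
  show ?thesis
  proof (cases W)
    case Nil
    then show ?thesis using b g by simp
  next
    case (Cons s W1)
    then obtain e c where W1: "W = (e, c) # W1" by (cases s) auto
    have c: "c \<in> base" "reduced W1" using reduced_ConsD[OF W[unfolded W1]] by auto
    obtain i where i: "- b + zmul m gx + b = zmul i (assoc_gen e)"
      using britton[OF x(1) x(1) b W[unfolded W1] g[unfolded W1] eq] by blast
    then have xb: "zmul m gx + b = b + zmul i (assoc_gen e)"
      by (metis add.assoc add_minus_cancel)
    then have "rho (zmul m gx + b) = rho (b + zmul i (assoc_gen e))" by simp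
    then have "Aff (of_int m) 0 + rho b = rho b + sub e i"
      by (simp only: rho_add b x base_zmul rho_zmul)
    then have "e \<and> i \<noteq> 0"
      using m by (cases e; cases "rho b") auto
    then have e: e and "i \<noteq> 0" by auto
    define h where "h = c + syllables W1"
    have "b + gt + (zmul i gy + h) = b + (gt + zmul i gy) + h"
      by (simp add: add.assoc)
    also have "\<dots> = (b + zmul i (assoc_gen e)) + gt + h"
      using e by (simp add: assoc_gen_def add.assoc flip: zmul_x_t)
    also have "\<dots> = zmul m gx + (b + (gt + h))"
      unfolding xb[symmetric] by (simp add: add.assoc)
    also have "\<dots> = b + gt + (h + zmul n gx)"
      using eq e by (simp add: g W1 h_def signed_def add.assoc)
    finally have yh: "zmul i gy + h = h + zmul n gx" by simp
    show ?thesis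
    proof (cases W1)
      case Nil
      then have "rho (zmul i gy + c) = rho (c + zmul n gx)" using yh by (simp add: h_def)
      then show ?thesis using c \<open>i \<noteq> 0\<close> by (cases "rho c") (simp add: rho_add x y)
    next
      case (Cons s' W2)
      then obtain e' c' where W2: "W1 = (e', c') # W2" by (cases s') auto
      obtain j where "- c + zmul i gy + c = zmul j (assoc_gen e')"
        using britton[OF y(1) x(1) c(1) c(2)[unfolded W2] h_def[unfolded W2] yh] by blast
      then have "zmul i gy + c = c + zmul j (assoc_gen e')"
        by (metis add.assoc add_minus_cancel)
      then have "rho (zmul i gy + c) = rho (c + zmul j (assoc_gen e'))" by simp
      then have rho: "Aff 0 i + rho c = rho c + sub e' j"
        by (simp only: rho_add c y base_zmul rho_zmul)
      then have e': "\<not> e'"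
        using \<open>i \<noteq> 0\<close> by (cases e'; cases "rho c") auto
      obtain r k where rc: "rho c = Aff r k" by (cases "rho c")
      \<comment> \<open>The first coordinates give 2^(-i) r = r with \<open>i\<close> nonzero, so
        \<open>c\<close> is a power of y.\<close>
      have "r = 0"
        using rho e' rc \<open>i \<noteq> 0\<close> by (auto dest: powi_eq_1D)
      then have "c = zmul k (assoc_gen False)"
        using rc by (intro rho_eq_sub c) simp
      then have "\<not> no_pinch (e, c) (e', c')"
        using e e' by (auto simp: no_pinch_def)
      then show ?thesis
        using W by (simp add: W1 W2 reduced_def)
    qed
  qed
qed

text \<open>If \<open>b\<close> lies in \<open>base\<close>, the exponents of y show that
  \<open>a\<close> has exponent 0 in y, so \<open>a\<close> is y^i x^m y^(-i). Otherwise
  \<open>britton\<close> makes \<open>a\<close> conjugate to a power of x or of y, and t^(-1) takes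
  the latter case to the former.\<close>

lemma base_conj_x_power:
  assumes a: "a \<in> base" and ab: "a + b = b + (a + a)"
  shows "\<exists>g m. a + g = g + zmul m gx"
proof -
  obtain b0 W where b0: "b0 \<in> base" and W: "reduced W" and b: "b = b0 + syllables W"
    using ex_reduced by blast
  show ?thesis
  proof (cases W)
    case Nil
    then have "rho (a + b0) = rho (b0 + (a + a))" using ab b by simp
    then have rho: "rho a + rho b0 = rho b0 + (rho a + rho a)"
      using a b0 by (simp add: rho_add base_add)
    obtain i m j where a': "a = zmul (int i) gy + zmul m gx - zmul (int j) gy"
      using a unfolding base_def by blast
    have "rho a = sub False (int i) + sub True m - sub False (int j)"
      unfolding a' using rhoI[OF nf_act_base_form] by metis
    then have "i = j"
      using rho by (cases "rho b0") (auto simp: minus_aff_def)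
    then have "a + zmul (int i) gy = zmul (int i) gy + zmul m gx"
      using a' by simp
    then show ?thesis by blast
  next
    case (Cons s W')
    then obtain e c where W': "W = (e, c) # W'" by (cases s) auto
    obtain m where m: "- b0 + a + b0 = zmul m (assoc_gen e)"
      using britton[OF a base_add[OF a a] b0 W[unfolded W'] b[unfolded W'] ab] by blast
    then have am: "a + b0 = b0 + zmul m (assoc_gen e)"
      by (metis add.assoc add_minus_cancel)
    show ?thesis
    proof (cases e)
      case True
      then have "a + b0 = b0 + zmul m gx" using am by (simp add: assoc_gen_def)
      then show ?thesis by blast
    next
      case False
      then have "a + (b0 + - gt) = b0 + (zmul m gy + - gt)"
        using am by (simp add: assoc_gen_def flip: add.assoc del: add_uminus_conv_diff)
      also have "zmul m gy + - gt = - gt + (gt + zmul m gy) + - gt"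
        by (simp add: add.assoc del: add_uminus_conv_diff)
      also have "\<dots> = - gt + zmul m gx"
        unfolding zmul_x_t[symmetric] by (simp only: add.assoc right_minus add_0_right)
      finally show ?thesis by (metis add.assoc)
    qed
  qed
qed

text \<open>A shortest word among the conjugates of \<open>a\<close> is cyclically reduced, so its
  powers are reduced without any loss of length.\<close>

lemma conj_double_imp_conj_base:
  assumes ab: "a + b = b + (a + a)"
  shows "\<exists>g. \<exists>a'\<in>base. a + g = g + a'"
proof (rule ccontr)
  assume no: "\<not> ?thesis"
  define Q where "Q W \<longleftrightarrow> over_base W \<and> (\<exists>g. a + g = g + syllables W)" for W
  \<comment> \<open>A leading element of \<open>base\<close> is moved to the end by conjugation and
    merged into the last syllable. With no syllable present, \<open>a\<close> would be conjugate
    into \<open>base\<close>, contrary to \<open>no\<close>.\<close>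
  have conj_c: "\<exists>V'. Q V' \<and> length V' = length V"
    if V: "over_base V" and c: "c \<in> base" and g: "a + g = g + (c + syllables V)" for V c g
  proof (cases V rule: rev_cases)
    case Nil
    then show ?thesis using no c g by auto
  next
    case (snoc U s)
    obtain e d where s: "s = (e, d)" by fastforce
    have "a + (g + c) = (g + c) + syllables (U @ [(e, d + c)])"
      using g by (simp add: snoc s syllables_append add.assoc flip: add.assoc[of a g])
    moreover have "over_base (U @ [(e, d + c)])"
      using V c by (simp add: over_base_def snoc s base_add)
    ultimately show ?thesis
      unfolding Q_def by (intro exI[of _ "U @ [(e, d + c)]"]) (auto simp: snoc)
  qed
  obtain c V where "c \<in> base" "reduced V" "a = c + syllables V"
    using ex_reduced by blast
  then have "\<exists>W. Q W"
    using conj_c[of V c 0] by (auto simp: reduced_def)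
  then obtain W where W: "Q W" and least: "\<And>V. Q V \<Longrightarrow> length W \<le> length V"
    using ex_has_least_nat[of Q _ length] by blast
  have W_ne: "W \<noteq> []"
  proof
    assume "W = []"
    then obtain g where "a + g = g + 0" using W by (auto simp: Q_def)
    then show False using no base_0 by blast
  qed
  have rotate: "Q (V @ U)" if Q: "Q (U @ V)" for U V
  proof -
    obtain g where "a + g = g + (syllables U + syllables V)"
      using Q by (auto simp: Q_def syllables_append)
    then have "a + (g + syllables U) = (g + syllables U) + (syllables V + syllables U)"
      by (simp add: add.assoc flip: add.assoc[of a g])
    then show ?thesis using Q by (auto simp: Q_def over_base_def syllables_append)
  qed
  \<comment> \<open>A pinch would yield a conjugate shorter by two syllables. By
    \<open>rotate\<close>, any cyclically adjacent pair can be brought to the front.\<close>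
  have front: "no_pinch s s'" if Q: "Q (s # s' # V)" and len: "length W = length (s # s' # V)" for s s' V
  proof (rule ccontr)
    assume "\<not> no_pinch s s'"
    then obtain e b' m where s: "s = (e, zmul m (assoc_gen (\<not> e)))" "s' = (\<not> e, b')"
      by (cases s; cases s') (auto simp: no_pinch_def)
    have "syllables (s # s' # V)
        = signed e gt + zmul m (assoc_gen (\<not> e)) + signed (\<not> e) gt + b' + syllables V"
      by (simp add: s add.assoc)
    then have "syllables (s # s' # V) = zmul m (assoc_gen e) + b' + syllables V"
      by (simp only: pinch)
    moreover have "zmul m (assoc_gen e) + b' \<in> base" "over_base V"
      using Q by (auto simp: Q_def over_base_def s base_add base_zmul)
    ultimately obtain V' where "Q V'" "length V' = length V"
      using conj_c[of V "zmul m (assoc_gen e) + b'"] Q unfolding Q_def by metis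
    then show False using least len by fastforce
  qed
  have succ: "successively no_pinch W"
    unfolding successively_conv_nth
  proof (intro allI impI)
    fix i
    assume i: "Suc i < length W"
    then have split: "W = take i W @ W ! i # W ! Suc i # drop (Suc (Suc i)) W"
      by (metis Cons_nth_drop_Suc Suc_lessD append_take_drop_id)
    then have "Q ((W ! i # W ! Suc i # drop (Suc (Suc i)) W) @ take i W)"
      using rotate W by metis
    then show "no_pinch (W ! i) (W ! Suc i)"
      by (intro front[of _ _ "drop (Suc (Suc i)) W @ take i W"]) (use i in auto)
  qed
  have cyclic: "no_pinch (last W) (hd W)"
  proof (cases "butlast W")
    case Nil
    then have "hd W = last W" using W_ne by (metis append_Nil append_butlast_last_id list.sel(1))
    then show ?thesis by (simp add: no_pinch_def)
  next
    case (Cons s V)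
    then have split: "W = (s # V) @ [last W]" using W_ne by (metis append_butlast_last_id)
    then have "Q ([last W] @ s # V)" using rotate W by metis
    moreover have "length W = length (last W # s # V)" "hd W = s" by (subst split, simp)+
    ultimately show ?thesis using front by simp
  qed
  \<comment> \<open>The word \<open>W\<close> repeated 2^k times; conjugation by \<open>h\<close>
    takes each of these powers to the next.\<close>
  define dbl where "dbl k = ((\<lambda>V. V @ V) ^^ k) W" for k
  have dbl_Suc: "dbl (Suc k) = dbl k @ dbl k" and dbl_0: "dbl 0 = W" for k
    by (simp_all add: dbl_def)
  have dbl: "dbl k \<noteq> [] \<and> hd (dbl k) = hd W \<and> last (dbl k) = last W
      \<and> length (dbl k) = 2 ^ k * length W \<and> reduced (dbl k)" for k
  proof (induction k)
    case 0
    then show ?case using W W_ne succ by (simp add: dbl_0 Q_def reduced_def)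
  next
    case (Suc k)
    then show ?case using cyclic
      by (simp add: dbl_Suc reduced_def over_base_def successively_append_iff)
  qed
  obtain g where g: "a + g = g + syllables W" using W by (auto simp: Q_def)
  define h where "h = - g + b + g"
  have sW: "syllables W = - g + a + g" using g by (simp add: add.assoc)
  have "syllables W + h = - g + (a + b) + g"
    by (simp add: sW h_def add.assoc)
  also have "\<dots> = h + (syllables W + syllables W)"
    unfolding ab by (simp add: sW h_def add.assoc)
  finally have step0: "syllables W + h = h + (syllables W + syllables W)" .
  have step: "syllables (dbl k) + h = h + syllables (dbl (Suc k))" for k
  proof (induction k)
    case 0
    show ?case using step0 by (simp add: dbl_Suc dbl_0 syllables_append)
  next
    case (Suc k)
    have "syllables (dbl (Suc k)) + h = syllables (dbl k) + (syllables (dbl k) + h)"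
      by (simp add: dbl_Suc syllables_append add.assoc)
    also have "\<dots> = h + (syllables (dbl (Suc k)) + syllables (dbl (Suc k)))"
      by (simp add: Suc add.assoc[symmetric])
    finally show ?case by (simp add: dbl_Suc[of "Suc k"] syllables_append)
  qed
  obtain C where C: "\<And>n. reduced_nf n \<Longrightarrow> nf_length (nf_act (syllables W) n) \<le> nf_length n + C"
    using nf_act_bounded by blast
  obtain D where D: "\<And>n. reduced_nf n \<Longrightarrow> nf_length (nf_act h n) \<le> nf_length n + D"
    using nf_act_bounded by blast
  obtain D' where D': "\<And>n. reduced_nf n \<Longrightarrow> nf_length (nf_act (- h) n) \<le> nf_length n + D'"
    using nf_act_bounded by blast
  \<comment> \<open>Each doubling is a conjugation by \<open>h\<close> and costs at most
    \<open>D + D'\<close>.\<close>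
  have linear: "nf_length (nf_act (syllables (dbl k)) n) \<le> nf_length n + C + k * (D + D')"
    if "reduced_nf n" for k n
    using that
  proof (induction k arbitrary: n)
    case 0
    then show ?case using C by (simp add: dbl_0)
  next
    case (Suc k)
    have "syllables (dbl (Suc k)) = - h + (syllables (dbl k) + h)"
      by (simp add: step)
    then have "nf_act (syllables (dbl (Suc k))) n
        = nf_act (- h) (nf_act (syllables (dbl k)) (nf_act h n))"
      using Suc.prems by (simp only: nf_act_add reduced_nf_act)
    then show ?case
      using D'[of "nf_act (syllables (dbl k)) (nf_act h n)"] Suc.IH[of "nf_act h n"] D[of n] Suc.prems
      by (simp add: reduced_nf_act)
  qed
  obtain k where k: "C + k * (D + D') < 2 ^ k" using ex_exp_gt_linear by blast
  have "2 ^ k \<le> length (dbl k)" using dbl[of k] W_ne by (cases W) auto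
  also have "\<dots> = nf_length (nf_act (syllables (dbl k)) (Base 0))"
    using nf_act_syllables[of "dbl k" 0] dbl[of k] by simp
  also have "\<dots> \<le> C + k * (D + D')" using linear[of "Base 0" k] by simp
  finally show False using k by simp
qed

text \<open>By \<open>normalizes_x_imp_base\<close>, \<open>b\<close> lies in \<open>base\<close>,
  and the doubling forces exponent 1 in y. So \<open>b\<close> is x^c y with \<open>c\<close>
  possibly fractional.\<close>

lemma conj_to_y:
  assumes m: "m \<noteq> 0" and b: "zmul m gx + b = b + zmul (2 * m) gx"
  shows "\<exists>d. zmul m gx + d = d + zmul m gx \<and> b + d = d + gy"
proof -
  have base: "b \<in> base" using normalizes_x_imp_base m b by blast
  have x: "zmul k gx \<in> base" "rho (zmul k gx) = Aff (of_int k) 0" for k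
    using base_zmul[of k True] rho_zmul[of k True] by (simp_all add: assoc_gen_def)
  obtain c k where ck: "rho b = Aff c k" by (cases "rho b")
  have "rho (zmul m gx + b) = rho (b + zmul (2 * m) gx)" using b by simp
  then have "2 powi (- k) * 2 = (1::rat)"
    using m by (simp add: rho_add x base ck)
  then have "(2::rat) powi (1 - k) = 1"
    by (simp add: power_int_diff power_int_minus field_simps)
  then have k: "k = 1" using powi_eq_1D by fastforce
  \<comment> \<open>Here \<open>b - gy\<close> is x^c, so \<open>d\<close> is x^(2c), and y x^(2c) =
    x^c y gives x^c y d = d y.\<close>
  define d where "d = (b - gy) + (b - gy)"
  have bd: "b - gy \<in> base" using base base_gen base_diff by blast
  have "rho (b - gy) = Aff c 0"
    using rho_add[OF base base_minus[OF base_gen(2)]] by (simp add: rho_minus base_gen rho_gen ck k)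
  then have d: "d \<in> base" "rho d = Aff (2 * c) 0"
    using bd by (simp_all add: d_def base_add rho_add)
  have "zmul m gx + d = d + zmul m gx"
    by (rule rho_inj) (simp_all add: base_add rho_add x d)
  moreover have "b + d = d + gy"
    by (rule rho_inj) (simp_all add: base_add rho_add d base base_gen rho_gen ck k power_int_minus)
  ultimately show ?thesis by blast
qed

lemma conj_to_x_y:
  fixes a b s :: bg
  assumes "a \<noteq> 0" and ab: "a + b = b + (a + a)" and as: "a + s = s + b"
  shows "\<exists>g. a + g = g + gx \<and> b + g = g + gy"
proof -
  obtain g1 a1 where a1: "a1 \<in> base" "a + g1 = g1 + a1"
    using conj_double_imp_conj_base[OF ab] by blast
  have a1': "a1 = - g1 + a + g1" using a1 by (simp add: add.assoc)
  have "a1 + (- g1 + b + g1) = - g1 + (a + b) + g1"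
    by (simp add: a1' add.assoc)
  also have "\<dots> = (- g1 + b + g1) + (a1 + a1)"
    unfolding ab by (simp add: a1' add.assoc)
  finally obtain g2 m where g2: "a1 + g2 = g2 + zmul m gx"
    using base_conj_x_power[OF a1(1)] by blast
  define g where "g = g1 + g2"
  have xm: "zmul m gx = - g + a + g"
  proof -
    have "zmul m gx = - g2 + (a1 + g2)" by (simp add: g2)
    then show ?thesis
      by (simp add: g_def a1' add.assoc minus_add del: add_uminus_conv_diff)
  qed
  have m: "m \<noteq> 0"
  proof
    assume "m = 0"
    then have "a + g = g" using xm by (simp add: add.assoc) (metis add_minus_cancel add.right_neutral)
    then show False using \<open>a \<noteq> 0\<close> add_right_cancel[of a g 0] by simp
  qed
  define b1 where "b1 = - g + b + g"
  have xm2: "zmul (2 * m) gx = - g + (a + a) + g"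
    using zmul_add[of m m gx] by (simp add: xm add.assoc)
  have "zmul m gx + b1 = - g + (a + b) + g" by (simp add: xm b1_def add.assoc)
  also have "\<dots> = b1 + zmul (2 * m) gx" unfolding ab by (simp add: xm2 b1_def add.assoc)
  finally obtain d where d: "zmul m gx + d = d + zmul m gx" "b1 + d = d + gy"
    using conj_to_y m by blast
  \<comment> \<open>The conjugate of \<open>s\<close> that takes x^m to y; hence
    \<open>s1 - gt\<close> takes x^m to x.\<close>
  define s1 where "s1 = - d + (- g + s + g) + d"
  have gy: "gy = - d + b1 + d" using d(2) by (simp add: add.assoc)
  have xm_d: "zmul m gx = - d + zmul m gx + d" using d(1) by (simp add: add.assoc)
  have "zmul m gx + s1 = - d + (- g + (a + s) + g) + d"
    by (subst xm_d) (simp add: xm s1_def add.assoc)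
  also have "\<dots> = s1 + gy"
    unfolding as by (simp add: gy b1_def s1_def add.assoc)
  finally have "zmul m gx + (s1 - gt) = (s1 - gt) + zmul 1 gx"
    unfolding bg_rel_xt[symmetric] by (simp add: diff_conv_add_uminus add.assoc del: add_uminus_conv_diff)
      (metis add.assoc add.right_neutral right_minus)
  then obtain h where h: "zmul m gx + h = h + gx" by auto
  have x: "gx = - h + zmul m gx + h" using h by (simp add: add.assoc)
  \<comment> \<open>Conjugation by \<open>h\<close> turns x^m into x but may move y. The image of y
    still doubles x, so \<open>conj_to_y\<close> with exponent 1 brings it back to y while fixing
    x.\<close>
  have "gx + (- h + gy + h) = - h + (zmul m gx + gy) + h"
    by (subst x) (simp add: add.assoc)
  also have "\<dots> = - h + (gy + (zmul m gx + zmul m gx)) + h"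
    using zmul_add[of m m gx] by (simp add: zmul_x_y)
  also have "\<dots> = (- h + gy + h) + (gx + gx)"
    using x by (simp add: add.assoc) (metis add.assoc add_minus_cancel h)
  finally have "zmul 1 gx + (- h + gy + h) = (- h + gy + h) + zmul (2 * 1) gx"
    using zmul_add[of 1 1 gx] by simp
  then obtain d' where d': "gx + d' = d' + gx" "(- h + gy + h) + d' = d' + gy"
    using conj_to_y[of 1] by auto
  define k where "k = g + (d + (h + d'))"
  have "a + k = k + gx"
  proof -
    have "a + g = g + zmul m gx" by (simp add: xm add.assoc)
    then show ?thesis using d(1) h d'(1) unfolding k_def by (metis add.assoc)
  qed
  moreover have "b + k = k + gy"
  proof -
    have "b + g = g + b1" by (simp add: b1_def add.assoc)
    moreover have "gy + (h + d') = (h + d') + gy"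
      using d'(2) by (simp add: add.assoc) (metis add.assoc add_minus_cancel)
    ultimately show ?thesis using d(2) unfolding k_def by (metis add.assoc)
  qed
  ultimately show ?thesis by blast
qed

section \<open>Endomorphisms\<close>

lemma additive_map_eq_on_base:
  assumes "additive_map f" "f gx = gx" "f gy = gy" "b \<in> base"
  shows "f b = b"
proof -
  interpret additive_map f by fact
  show ?thesis using assms(4) unfolding base_def by (auto simp: add diff zmul assms)
qed

lemma bg_rel_xy': "gx + gy = gy + (gx + gx)"
  by (simp add: add.assoc flip: bg_rel_xy)

lemma bg_rel_xt': "gx + gt = gt + gy"
  by (simp add: add.assoc flip: bg_rel_xt)

lemma endomorphism_bij:
  fixes f :: "bg \<Rightarrow> bg"
  assumes "additive_map f" "f gx \<noteq> 0"
  shows "bij f"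
proof -
  interpret f: additive_map f by fact
  have "f gx + f gy = f gy + (f gx + f gx)" "f gx + f gt = f gt + f gy"
    by (metis f.add bg_rel_xy', metis f.add bg_rel_xt')
  then obtain g where g: "f gx + g = g + gx" "f gy + g = g + gy"
    using conj_to_x_y assms(2) by blast
  define h where "h a = - g + f a + g" for a
  have h: "additive_map h"
    by unfold_locales (simp add: h_def f.add add.assoc)
  interpret h: additive_map h by fact
  have hxy: "h gx = gx" "h gy = gy" using g by (simp_all add: h_def add.assoc)
  define c where "c = h gt - gt"
  have "gx + h gt = h gt + gy" using bg_rel_xt' h.add hxy by metis
  then have cx: "gx + c = c + gx"
    unfolding c_def bg_rel_xt[symmetric]
    by (simp add: diff_conv_add_uminus add.assoc del: add_uminus_conv_diff)
      (metis add.assoc add.right_neutral right_minus)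
  then have c: "c \<in> base" using normalizes_x_imp_base[of 1 c 1] by simp
  \<comment> \<open>The candidate inverse of \<open>h\<close>. It respects the relations because
    \<open>c\<close> centralizes x, and it inverts \<open>h\<close> because both maps fix
    \<open>c\<close>, an element of \<open>base\<close>.\<close>
  define \<phi> where "\<phi> l = (if l = BG_t then - c + gt else gen l)" for l
  have "- (- c + gt) + gx + (- c + gt) = - gt + (c + gx) + (- c + gt)"
    by (simp add: minus_add add.assoc)
  also have "\<dots> = gy"
    by (simp add: cx[symmetric] add.assoc) (metis add.assoc bg_rel_xt)
  finally obtain k where k: "additive_map k" "\<And>l. k (gen l) = \<phi> l"
    using bg_universal[of \<phi>] bg_rel_xy by (auto simp: \<phi>_def)
  interpret k: additive_map k by fact
  have hc: "h c = c" and kc: "k c = c"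
    using additive_map_eq_on_base h k(1) c hxy k(2) by (auto simp: \<phi>_def)
  have ht: "h gt = c + gt" by (simp add: c_def)
  have "k (h a) = a" for a
  proof (rule additive_map_id[of "\<lambda>a. k (h a)"])
    show "additive_map (\<lambda>a. k (h a))" by unfold_locales (simp add: h.add k.add)
    show "k (h (gen l)) = gen l" for l
      by (cases l) (simp_all add: hxy ht k \<phi>_def k.add kc)
  qed
  moreover have "h (k a) = a" for a
  proof (rule additive_map_id[of "\<lambda>a. h (k a)"])
    show "additive_map (\<lambda>a. h (k a))" by unfold_locales (simp add: h.add k.add)
    show "h (k (gen l)) = gen l" for l
      by (cases l) (simp_all add: hxy ht k \<phi>_def h.add h.minus hc)
  qed
  ultimately have "bij h" by (intro o_bij[of k]) auto
  moreover have "bij (\<lambda>a. g + a - g)"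
    by (intro o_bij[of "\<lambda>a. - g + a + g"]) (auto simp: add.assoc diff_conv_add_uminus simp del: add_uminus_conv_diff)
  moreover have "f = (\<lambda>a. g + a - g) \<circ> h"
    by (auto simp: h_def add.assoc diff_conv_add_uminus simp del: add_uminus_conv_diff)
  ultimately show ?thesis using bij_comp by metis
qed

lemma gx_nonzero: "gx \<noteq> 0"
  using rho_gen(1) rho_0 by (auto simp: zero_aff_def)

lemma endomorphism_trivial_on_x:
  fixes f :: "bg \<Rightarrow> bg"
  assumes "additive_map f" "f gx = 0"
  shows "\<not> inj f" "\<not> surj f"
proof -
  interpret f: additive_map f by fact
  show "\<not> inj f" using assms(2) gx_nonzero by (metis f.zero injD)
  have fy: "f gy = 0"
    unfolding bg_rel_xt[symmetric] f.add f.minus by (simp add: assms(2))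
  have cyclic: "\<exists>m. f a = zmul m (f gt)" for a
  proof (induction a rule: bg_induct)
    case zero
    show ?case using zmul_0 f.zero by metis
  next
    case (letter l e a)
    then obtain m where m: "f a = zmul m (f gt)" by blast
    obtain n where "f (signed e (gen l)) = zmul n (f gt)"
      using zmul_1[of "f gt"] zmul_minus[of 1 "f gt"] zmul_0[of "f gt"]
      by (cases l; cases e) (metis assms(2) fy f.minus signed_def minus_zero)+
    then show ?case using m f.add zmul_add by metis
  qed
  show "\<not> surj f"
  proof
    assume "surj f"
    then obtain u v where "f u = gx" "f v = gy" by (metis surjD)
    then obtain m n where "gx = zmul m (f gt)" "gy = zmul n (f gt)" using cyclic by metis
    \<comment> \<open>A cyclic image is abelian, and commuting x and y would force x to be
      trivial.\<close>
    then have "gx + gy = gy + gx" by (metis zmul_add add.commute)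
    then have "gx = gx + gx" using bg_rel_xy' by (metis add_left_cancel)
    then show False using gx_nonzero add_left_cancel[of gx 0 gx] by simp
  qed
qed

text \<open>Either alternative in \<open>cond\<close> rules out that x is killed, so one argument
  serves both properties. The rest transfers bijectivity between the type \<open>bg\<close> and the
  carrier.\<close>

lemma hom_bij_imp_iso:
  assumes f: "f \<in> hom baumslag_gersten baumslag_gersten"
    and cond: "f ` carrier baumslag_gersten = carrier baumslag_gersten
      \<or> inj_on f (carrier baumslag_gersten)"
  shows "f \<in> iso baumslag_gersten baumslag_gersten"
proof -
  let ?G = "baumslag_gersten"
  define F where "F a = Abs_bg (f (Rep_bg a))" for a
  have closed: "f A \<in> carrier ?G" if "A \<in> carrier ?G" for A
    using f that by (auto simp: hom_def)
  have Rep_F: "Rep_bg (F a) = f (Rep_bg a)" for a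
    by (simp add: F_def Abs_bg_inverse closed Rep_bg)
  have F: "additive_map F"
  proof
    fix a b
    have "Rep_bg (a + b) = Rep_bg a \<otimes>\<^bsub>?G\<^esub> Rep_bg b" for a b
      by (simp add: plus_bg_def Abs_bg_inverse Rep_bg)
    then show "F (a + b) = F a + F b"
      using f by (simp add: Rep_F hom_mult Rep_bg flip: Rep_bg_inject)
  qed
  have carrier: "\<exists>a. A = Rep_bg a" if "A \<in> carrier ?G" for A
    using that by (metis Abs_bg_inverse)
  from cond have "F gx \<noteq> 0"
  proof
    assume surj: "f ` carrier ?G = carrier ?G"
    have "\<exists>a. F a = b" for b
    proof -
      obtain A where "A \<in> carrier ?G" "f A = Rep_bg b"
        using surj Rep_bg[of b] by (metis imageE)
      then show ?thesis using carrier Rep_F by (metis Rep_bg_inject)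
    qed
    then have "surj F" by (metis surjI)
    then show ?thesis using endomorphism_trivial_on_x(2)[OF F] by blast
  next
    assume "inj_on f (carrier ?G)"
    then have "inj F"
      by (intro injI) (metis Rep_F Rep_bg Rep_bg_inject inj_onD)
    then show ?thesis using endomorphism_trivial_on_x(1)[OF F] by blast
  qed
  then have bij: "bij F" by (rule endomorphism_bij[OF F])
  have "bij_betw f (carrier ?G) (carrier ?G)"
  proof (rule bij_betw_imageI)
    show "inj_on f (carrier ?G)"
    proof (rule inj_onI)
      fix A B
      assume AB: "A \<in> carrier ?G" "B \<in> carrier ?G" "f A = f B"
      obtain a b where ab: "A = Rep_bg a" "B = Rep_bg b" using carrier AB by blast
      have "F a = F b" using AB by (simp add: F_def ab)
      then have "a = b" using bij_is_inj[OF bij] by (rule injD[rotated])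
      then show "A = B" by (simp only: ab)
    qed
    show "f ` carrier ?G = carrier ?G"
    proof (intro equalityI subsetI)
      fix B assume "B \<in> carrier ?G"
      then obtain b where "B = Rep_bg b" using carrier by blast
      moreover obtain a where "b = F a" using bij_is_surj[OF bij] by (rule surjE)
      ultimately have "B = f (Rep_bg a)" by (simp only: Rep_F)
      then show "B \<in> f ` carrier ?G" using Rep_bg by (rule image_eqI)
    qed (use closed in auto)
  qed
  with f show ?thesis unfolding iso_def by (intro CollectI conjI)
qed

theorem mainTheorem3:
  shows "hopfian baumslag_gersten \<and> co_hopfian baumslag_gersten"
  unfolding hopfian_def co_hopfian_def by (intro conjI ballI impI hom_bij_imp_iso disjI1 disjI2)

end
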